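(* Let $X$ be a real or complex Banach space, let $A:\mathbb{N}\to\mathcal{B}(X)$ be a sequence, and consider the linear discrete-time system $x_{n+1}=A(n)x_n$ with associated operators $A_m^n$, $(m,n)\in\Delta$. The system is nonuniformly exponentially stable if and only if there exist a constant $d>0$ and a nondecreasing function $N:\mathbb{R}_+\to[1,\infty)$ such that $$\sum_{m=n}^{\infty}e^{d(m-n)}\|A_m^p x\|\le N(n)\|A_n^p x\|\quad\text{for all }(n,p)\in\Delta\text{ and }x\in X.$$
   Context: $\mathbb{N}=\{0,1,2,\dots\}$ and $\mathbb{R}_+=[0,\infty)$. $\mathcal{B}(X)$ is the Banach algebra of bounded linear operators on $X$, and $I$ is the identity operator. $\Delta$ is the set of pairs $(m,n)$ of nonnegative integers with $m\ge n$. $T$ is the set of triples $(m,n,p)$ of nonnegative integers with $(m,n)\in\Delta$ and $(n,p)\in\Delta$. For $(m,n)\in\Delta$, $A_m^n=A(m)A(m-1)\cdots A(n+1)$ if $m\ge n+1$, and $A_m^n=I$ if $m=n$. An inequality bounding an infinite series of nonnegative terms includes the assertion that the series converges. The system is nonuniformly exponentially stable if there exist a constant $\alpha>0$ and a nondecreasing function $N:\mathbb{R}_+\to[1,\infty)$ such that $\|A_m^p x\|\le N(n)e^{-\alpha(m-n)}\|A_n^p x\|$ for all $(m,n,p)\in T$ and $x\in X$. *)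

theory Defs
  imports "HOL-Analysis.Analysis"
begin

text \<open>
  The space is a type of class \<^class>\<open>banach\<close>, a real Banach space. Complex Banach spaces are
  included by restriction of scalars: the norm is unchanged and bounded complex-linear operators
  are in particular bounded real-linear operators.
\<close>

definition Delta :: "(nat \<times> nat) set" where
  "Delta = {(m, n). n \<le> m}"

definition Triples :: "(nat \<times> nat \<times> nat) set" where
  "Triples = {(m, n, p). (m, n) \<in> Delta \<and> (n, p) \<in> Delta}"

text \<open>
  The operator \<open>evol A m n\<close> is \<open>A m \<circ> A (m - 1) \<circ> \<dots> \<circ> A (n + 1)\<close> for \<open>n < m\<close> and the identity for
  \<open>m = n\<close>; it is meaningful only for \<open>(m, n) \<in> Delta\<close>.
\<close>

primrec evol :: "(nat \<Rightarrow> 'a::real_normed_vector \<Rightarrow>\<^sub>L 'a) \<Rightarrow> nat \<Rightarrow> nat \<Rightarrow> 'a \<Rightarrow>\<^sub>L 'a" where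
  "evol A 0 n = id_blinfun"
| "evol A (Suc m) n = (if n \<le> m then A (Suc m) o\<^sub>L evol A m n else id_blinfun)"

text \<open>
  Functions from \<open>[0, \<infinity>)\<close> to \<open>[1, \<infinity>)\<close> are functions on all reals whose values at negative
  arguments are irrelevant.
\<close>

definition growth_function :: "(real \<Rightarrow> real) \<Rightarrow> bool" where
  "growth_function N \<longleftrightarrow> N \<in> {0..} \<rightarrow> {1..} \<and> mono_on {0..} N"

definition nonuniformly_exponentially_stable ::
    "(nat \<Rightarrow> 'a::real_normed_vector \<Rightarrow>\<^sub>L 'a) \<Rightarrow> bool" where
  "nonuniformly_exponentially_stable A \<longleftrightarrow>
    (\<exists>\<alpha> N. \<alpha> > 0 \<and> growth_function N \<and>
      (\<forall>(m, n, p) \<in> Triples. \<forall>x.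
        norm (evol A m p x) \<le> N (real n) * exp (- \<alpha> * (real m - real n)) * norm (evol A n p x)))"

end

theory Submission imports Defs begin

text \<open>Fix \<open>n\<close>, \<open>p\<close>, \<open>x\<close> and look only at the
  nonnegative scalar sequence f(m) = \<open>norm (evol A m p x)\<close> for m \<ge> n; both
  directions are facts about such sequences. If f(m) is at most K times e^(-\<alpha>(m-n)) and 0 < d
  < \<alpha>, then weighting by e^(d(m-n)) leaves a majorant that is a geometric series of ratio
  e^(-(\<alpha>-d)), so the weighted sum converges and is at most K/(1 - e^(-(\<alpha>-d)))
  (\<open>exp_weighted_sum_le\<close>). This factor depends on \<alpha> and d alone, hence can be
  absorbed into \<open>N\<close>. Conversely, one term of a convergent nonnegative series is at most
  its sum, and dividing by the weight gives decay at rate d with the same \<open>N\<close>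
  (\<open>exp_weighted_sum_term_le\<close>).\<close>

lemma has_sum_exp_decay_atLeast:
  fixes c :: real
  assumes "c > 0"
  shows "((\<lambda>m. exp (- c * (real m - real n))) has_sum 1 / (1 - exp (- c))) {n..}"
proof -
  have "(\<lambda>k. exp (- c) ^ k) sums (1 / (1 - exp (- c)))"
    using assms by (intro geometric_sums) simp
  then have "((\<lambda>k. exp (- c) ^ k) has_sum 1 / (1 - exp (- c))) UNIV"
    by (rule sums_nonneg_imp_has_sum) simp
  \<comment> \<open>The shift k = m - n carries the geometric series over all naturals to the tail
    starting at \<open>n\<close>.\<close>
  moreover have "(\<lambda>k. exp (- c) ^ k) = (\<lambda>m. exp (- c * (real m - real n))) \<circ> (\<lambda>k. k + n)"
    by (simp add: fun_eq_iff exp_of_nat_mult[symmetric] algebra_simps)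
  moreover have "(\<lambda>k. k + n) ` UNIV = {n..}"
    by (auto simp: image_iff) (metis add.commute le_iff_add)
  ultimately show ?thesis
    by (metis has_sum_reindex inj_on_add')
qed

text \<open>Comparison with a geometric series: the weight costs d of the decay rate \<alpha>, and
  the remaining rate \<alpha> - d is still positive.\<close>

lemma exp_weighted_sum_le:
  fixes f :: "nat \<Rightarrow> real"
  assumes "d < \<alpha>" and nonneg: "\<And>m. n \<le> m \<Longrightarrow> 0 \<le> f m"
    and decay: "\<And>m. n \<le> m \<Longrightarrow> f m \<le> K * exp (- \<alpha> * (real m - real n))"
  shows "(\<lambda>m. exp (d * (real m - real n)) * f m) summable_on {n..}"
    and "(\<Sum>\<^sub>\<infinity>m\<in>{n..}. exp (d * (real m - real n)) * f m) \<le> K * (1 / (1 - exp (- (\<alpha> - d))))"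
proof -
  define g where "g = (\<lambda>m. K * exp (- (\<alpha> - d) * (real m - real n)))"
  have g: "(g has_sum K * (1 / (1 - exp (- (\<alpha> - d))))) {n..}"
    unfolding g_def using assms(1)
    by (intro has_sum_cmult_right has_sum_exp_decay_atLeast) simp
  have le: "exp (d * (real m - real n)) * f m \<le> g m" if "m \<in> {n..}" for m
  proof -
    have "exp (d * (real m - real n)) * f m
        \<le> exp (d * (real m - real n)) * (K * exp (- \<alpha> * (real m - real n)))"
      using that by (intro mult_left_mono decay) auto
    also have "\<dots> = g m"
      by (simp add: g_def exp_add[symmetric] algebra_simps)
    finally show ?thesis .
  qed
  show summable: "(\<lambda>m. exp (d * (real m - real n)) * f m) summable_on {n..}"
    using has_sum_imp_summable[OF g] le by (rule summable_on_comparison_test) (auto simp: nonneg)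
  show "(\<Sum>\<^sub>\<infinity>m\<in>{n..}. exp (d * (real m - real n)) * f m) \<le> K * (1 / (1 - exp (- (\<alpha> - d))))"
    using has_sum_infsum[OF summable] g le by (rule has_sum_mono)
qed

lemma exp_weighted_sum_term_le:
  fixes f :: "nat \<Rightarrow> real"
  assumes summable: "(\<lambda>m. exp (d * (real m - real n)) * f m) summable_on {n..}"
    and nonneg: "\<And>m. n \<le> m \<Longrightarrow> 0 \<le> f m" and "n \<le> m"
  shows "f m \<le> exp (- d * (real m - real n)) *
    (\<Sum>\<^sub>\<infinity>m\<in>{n..}. exp (d * (real m - real n)) * f m)"
proof -
  \<comment> \<open>The term at \<open>m\<close> is written as a sum over a singleton, so that
    enlarging the index set only adds nonnegative terms.\<close>
  have "(\<Sum>\<^sub>\<infinity>m\<in>{m}. exp (d * (real m - real n)) * f m)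
      \<le> (\<Sum>\<^sub>\<infinity>m\<in>{n..}. exp (d * (real m - real n)) * f m)"
    using assms by (intro infsum_mono_neutral) auto
  then show ?thesis
    by (simp add: exp_minus inverse_eq_divide pos_le_divide_eq mult.commute)
qed

text \<open>The bound 1 \<le> c keeps the values in [1, \<infinity>) after the constant is
  absorbed.\<close>

lemma growth_function_mult_const:
  assumes "growth_function N" and "1 \<le> c"
  shows "growth_function (\<lambda>t. N t * c)"
proof -
  have "1 \<le> N t * c" if "0 \<le> t" for t
  proof -
    have "1 \<le> N t"
      using assms(1) that by (auto simp: growth_function_def)
    then show ?thesis
      using mult_mono[of 1 "N t" 1 c] assms(2) by simp
  qed
  with assms show ?thesis
    by (auto simp: growth_function_def mono_on_def intro: mult_right_mono)
qed

theorem theorem4: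
  fixes A :: "nat \<Rightarrow> 'a::banach \<Rightarrow>\<^sub>L 'a"
  shows "nonuniformly_exponentially_stable A \<longleftrightarrow>
    (\<exists>d N. d > 0 \<and> growth_function N \<and>
      (\<forall>(n, p) \<in> Delta. \<forall>x.
        (\<lambda>m. exp (d * (real m - real n)) * norm (evol A m p x)) summable_on {n..} \<and>
        (\<Sum>\<^sub>\<infinity>m\<in>{n..}. exp (d * (real m - real n)) * norm (evol A m p x))
          \<le> N (real n) * norm (evol A n p x)))"
    (is "_ \<longleftrightarrow> (\<exists>d N. ?summable d N)")
proof
  assume "nonuniformly_exponentially_stable A"
  then obtain \<alpha> N where "\<alpha> > 0" and N: "growth_function N"
    and stable: "\<And>m n p x. (m, n, p) \<in> Triples \<Longrightarrow>
      norm (evol A m p x) \<le> N (real n) * exp (- \<alpha> * (real m - real n)) * norm (evol A n p x)"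
    unfolding nonuniformly_exponentially_stable_def by blast
  \<comment> \<open>Any rate strictly between 0 and \<alpha> would serve; \<open>c\<close> is the
    sum of the resulting geometric series.\<close>
  define d where "d = \<alpha> / 2"
  define c where "c = 1 / (1 - exp (- (\<alpha> - d)))"
  have d: "0 < d" "d < \<alpha>"
    using \<open>\<alpha> > 0\<close> by (auto simp: d_def)
  \<comment> \<open>The denominator of \<open>c\<close> lies strictly between 0 and 1.\<close>
  then have "1 \<le> c"
    by (simp add: c_def)
  have "(\<lambda>m. exp (d * (real m - real n)) * norm (evol A m p x)) summable_on {n..} \<and>
      (\<Sum>\<^sub>\<infinity>m\<in>{n..}. exp (d * (real m - real n)) * norm (evol A m p x))
        \<le> N (real n) * c * norm (evol A n p x)" if "(n, p) \<in> Delta" for n p x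
  proof -
    \<comment> \<open>Regrouped so that K = \<open>N (real n) * norm (evol A n p x)\<close>, which
      does not depend on \<open>m\<close>.\<close>
    have "norm (evol A m p x) \<le> N (real n) * norm (evol A n p x) * exp (- \<alpha> * (real m - real n))"
      if "n \<le> m" for m
      using stable[of m n p x] that \<open>(n, p) \<in> Delta\<close>
      by (simp add: Triples_def Delta_def mult_ac)
    from exp_weighted_sum_le[OF \<open>d < \<alpha>\<close> norm_ge_zero this] show ?thesis
      by (simp add: c_def mult_ac)
  qed
  then have "?summable d (\<lambda>t. N t * c)"
    using d growth_function_mult_const[OF N \<open>1 \<le> c\<close>] by blast
  then show "\<exists>d N. ?summable d N"
    by (intro exI)
next
  assume "\<exists>d N. ?summable d N"
  then obtain d N where "d > 0" and N: "growth_function N"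
    and summable: "\<And>n p x. (n, p) \<in> Delta \<Longrightarrow>
      (\<lambda>m. exp (d * (real m - real n)) * norm (evol A m p x)) summable_on {n..}"
    and bound: "\<And>n p x. (n, p) \<in> Delta \<Longrightarrow>
      (\<Sum>\<^sub>\<infinity>m\<in>{n..}. exp (d * (real m - real n)) * norm (evol A m p x))
        \<le> N (real n) * norm (evol A n p x)"
    by blast
  have "norm (evol A m p x) \<le> N (real n) * exp (- d * (real m - real n)) * norm (evol A n p x)"
    if "(m, n, p) \<in> Triples" for m n p x
  proof -
    have "(n, p) \<in> Delta" "n \<le> m"
      using that by (auto simp: Triples_def Delta_def)
    then have "norm (evol A m p x) \<le> exp (- d * (real m - real n)) *
        (\<Sum>\<^sub>\<infinity>m\<in>{n..}. exp (d * (real m - real n)) * norm (evol A m p x))"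
      by (intro exp_weighted_sum_term_le summable) auto
    also have "\<dots> \<le> exp (- d * (real m - real n)) * (N (real n) * norm (evol A n p x))"
      using \<open>(n, p) \<in> Delta\<close> by (intro mult_left_mono bound) auto
    finally show ?thesis
      by (simp add: mult_ac)
  qed
  then show "nonuniformly_exponentially_stable A"
    unfolding nonuniformly_exponentially_stable_def using \<open>d > 0\<close> N by blast
qed

end
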